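(* Let $\lambda>0$ and let $\mu_\lambda$ be a standard probability measure on $\mathbb{R}$ with finite moments of all orders, having a generating function for orthogonal polynomials of ultraspherical type with parameter $\lambda$ on a region $S$, with functions $u_\lambda,f_\lambda$, and satisfying the interchange condition for $z\in S$ (these notions are defined in the context). Let $\alpha_1^\lambda$ and $\omega_2^\lambda$ be the corresponding Jacobi-Szegő parameters of $\mu_\lambda$. Then: (1) The function $f_\lambda$ satisfies, for $z\in S$, $$Q_2(z)f_\lambda'(z)=f_\lambda^2(z)-Q_1(z)f_\lambda(z)+R_1(z),$$ where $Q_2,R_1$ are polynomials of degree $2$ while $Q_1$ is a polynomial of degree $1$. Moreover, the coefficients of these polynomials depend only on $\lambda,\alpha_1^\lambda,\omega_2^\lambda$. (2) The function $u_\lambda$ is related to $f_\lambda$ by $$\frac{u_\lambda'(z)}{u_\lambda(z)}=\lambda\,\frac{1-f_\lambda'(z)}{f_\lambda(z)-\lambda z}.$$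
   Context: Orthogonal polynomials and standardness: $(P_n^\lambda)_{n\ge0}$ denotes the monic orthogonal polynomials of $\mu_\lambda$. They satisfy $xP_n^\lambda(x)=P_{n+1}^\lambda(x)+\alpha_n^\lambda P_n^\lambda(x)+\omega_n^\lambda P_{n-1}^\lambda(x)$ for $n\ge0$, with $P_{-1}^\lambda:=0$ and $\omega_0^\lambda=1$. The sequences $(\alpha_n^\lambda)_{n\ge0}$, $(\omega_n^\lambda)_{n\ge0}$ are the Jacobi-Szegő parameters of $\mu_\lambda$ (with $\omega_n^\lambda>0$ for all $n$ unless $\mu_\lambda$ has finite support). Standard means that $\mu_\lambda$ has zero mean and unit variance, equivalently $\alpha_0^\lambda=0$, $\omega_1^\lambda=1$. Notation: $(\lambda)_n=(\lambda+n-1)\cdots(\lambda+1)\lambda$, with $(\lambda)_0=1$. Complex powers are taken with the principal determination of the logarithm. Generating function of ultraspherical type with parameter $\lambda>0$: $$\psi_\lambda(z,x):=\sum_{n\ge0}\frac{(\lambda)_n}{n!}P_n^\lambda(x)z^n=\frac{1}{u_\lambda(z)(f_\lambda(z)-x)^\lambda},$$ valid for $x\in\mathrm{supp}(\mu_\lambda)$ and $z$ in an open region $S$ of the complex plane near $z=0$, cut from $z=0$ along the negative real axis, where $u_\lambda,f_\lambda$ are analytic with $$\lim_{z\to0}zf_\lambda(z)=1,\qquad \lim_{z\to0,\,z\in S}\frac{u_\lambda(z)}{z^\lambda}=1,\qquad \Im(f_\lambda(z))\neq0\ \text{ for } z\in S.$$ Interchange condition: for $i\in\{0,1,2\}$ and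 $z\in S$, $$\int\sum_{n\ge0}\frac{(\lambda)_n}{n!}\,x^iP_n^\lambda(x)z^n\,\mu_\lambda(dx)=\sum_{n\ge0}\frac{(\lambda)_n}{n!}\left(\int x^iP_n^\lambda(x)\,\mu_\lambda(dx)\right)z^n.$$
   Formalization: Degrees of Q_2, Q_1, R_1 are proved to be at most 2, 1, 2, and exactly so unless (λ+1)ω_2=2λ (for Q_2) or ω_2=0 (for Q_1, R_1), since leading coefficients can vanish, e.g. for the ±1 law; (2) is asserted where f_λ(z)≠λz, so that the quotient is defined. *)

theory Defs
  imports "HOL-Probability.Probability" "HOL-Computational_Algebra.Polynomial"
begin

definition measure_supp :: "real measure \<Rightarrow> real set" where
  "measure_supp M = {x. \<forall>U. open U \<and> x \<in> U \<longrightarrow> emeasure M U > 0}"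

definition finite_moments :: "real measure \<Rightarrow> bool" where
  "finite_moments M \<longleftrightarrow> (\<forall>n::nat. integrable M (\<lambda>x. x ^ n))"

definition standard_measure :: "real measure \<Rightarrow> bool" where
  "standard_measure M \<longleftrightarrow>
     (LINT x|M. x) = 0 \<and> (LINT x|M. (x - (LINT y|M. y))\<^sup>2) = 1"

definition monic_orthogonal_polys :: "real measure \<Rightarrow> (nat \<Rightarrow> real poly) \<Rightarrow> bool" where
  "monic_orthogonal_polys M P \<longleftrightarrow>
     (\<forall>n. degree (P n) = n \<and> lead_coeff (P n) = 1) \<and>
     (\<forall>m n. m \<noteq> n \<longrightarrow> (LINT x|M. poly (P m) x * poly (P n) x) = 0)"

(* The if-expression encodes the convention that the polynomial with index -1 is 0.
   If M is supported on exactly N points, the P n with n > N and the \<omega> n with n > N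
   are not determined by M; P n with n \<le> N, \<alpha> n with n < N and \<omega> n with n \<le> N are. *)
definition jacobi_szego ::
    "(nat \<Rightarrow> real poly) \<Rightarrow> (nat \<Rightarrow> real) \<Rightarrow> (nat \<Rightarrow> real) \<Rightarrow> bool" where
  "jacobi_szego P \<alpha> \<omega> \<longleftrightarrow> \<omega> 0 = 1 \<and>
     (\<forall>n. [:0, 1:] * P n =
        P (Suc n) + smult (\<alpha> n) (P n) + smult (\<omega> n) (if n = 0 then 0 else P (n - 1)))"

(* Since z * f z tends to 1, Im (f z) has the sign of - Im z near 0 away from the real axis. Hence
   a function f with Im (f z) \<noteq> 0 everywhere on the region cannot exist on a full slit disc. The set
   is only required to be open, to accumulate at 0 and to avoid the cut; connectedness is not
   imposed, so that a half disc and a disc without its real diameter are both covered. *)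
definition slit_region :: "complex set \<Rightarrow> bool" where
  "slit_region S \<longleftrightarrow> open S \<and> 0 \<in> closure S \<and> S \<inter> \<real>\<^sub>\<le>\<^sub>0 = {}"

definition ultraspherical_gf ::
    "real \<Rightarrow> real measure \<Rightarrow> (nat \<Rightarrow> real poly) \<Rightarrow> complex set \<Rightarrow>
     (complex \<Rightarrow> complex) \<Rightarrow> (complex \<Rightarrow> complex) \<Rightarrow> bool" where
  "ultraspherical_gf l M P S u f \<longleftrightarrow>
     slit_region S \<and> u analytic_on S \<and> f analytic_on S \<and>
     ((\<lambda>z. z * f z) \<longlongrightarrow> 1) (at 0 within S) \<and>
     ((\<lambda>z. u z / z powr of_real l) \<longlongrightarrow> 1) (at 0 within S) \<and>
     (\<forall>z\<in>S. Im (f z) \<noteq> 0) \<and>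
     (\<forall>x\<in>measure_supp M. \<forall>z\<in>S.
        (\<lambda>n. of_real (pochhammer l n / fact n * poly (P n) x) * z ^ n)
          sums (1 / (u z * (f z - of_real x) powr of_real l)))"

definition interchange_condition ::
    "real \<Rightarrow> real measure \<Rightarrow> (nat \<Rightarrow> real poly) \<Rightarrow> complex set \<Rightarrow> bool" where
  "interchange_condition l M P S \<longleftrightarrow>
     (\<forall>i\<in>{0, 1, 2::nat}. \<forall>z\<in>S.
        (LINT x|M. (\<Sum>n. complex_of_real (pochhammer l n / fact n * (x ^ i * poly (P n) x)) * z ^ n))
        = (\<Sum>n. complex_of_real (pochhammer l n / fact n * (LINT x|M. x ^ i * poly (P n) x)) * z ^ n))"

end

theory Submission
  imports Defs
begin

text \<open>Put \<open>T s w = \<integral> (w - x) powr s d\<mu>(x)\<close>. Integrating \<open>1\<close>, \<open>x\<close> and \<open>x\<^sup>2\<close> against the generating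
  function and using orthogonality on the series side gives \<open>T (-l) f = u\<close>,
  \<open>T (1 - l) f = u (f - l z)\<close> and \<open>T (2 - l) f = u (f\<^sup>2 - 2 l z f + q)\<close> with
  \<open>q = 1 + l \<alpha>\<^sub>1 z + l (l + 1) / 2 \<omega>\<^sub>2 z\<^sup>2\<close>. Since \<open>(T s)' = s T (s - 1)\<close>, differentiating the second
  identity in \<open>z\<close> gives the equation for \<open>u' / u\<close>, and differentiating the third and eliminating
  \<open>u'\<close> gives the Riccati equation for \<open>f\<close>.\<close>

section \<open>Support of the measure and integrability of polynomials\<close>

text \<open>The complement of the support is the union of all open null sets, and by Lindelof
  countably many of them already have that union. This makes the generating function, known only on
  the support, usable under the integral.\<close>

lemma (in real_distribution) AE_measure_supp: "AE x in M. x \<in> measure_supp M"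
proof -
  define F where "F = {U. open U \<and> emeasure M U = 0}"
  obtain F' where F': "F' \<subseteq> F" "countable F'" "\<Union>F' = \<Union>F"
    using Lindelof[of F] by (auto simp: F_def)
  have "(\<Union>U\<in>F'. U) \<in> null_sets M"
    using F' by (intro null_sets_UN') (auto simp: F_def null_sets_def)
  then have "AE x in M. x \<notin> \<Union>F"
    using F'(3) by (intro AE_not_in) simp
  then show ?thesis
    by eventually_elim (auto simp: measure_supp_def F_def zero_less_iff_neq_zero)
qed

lemma integrable_poly:
  assumes "finite_moments M"
  shows "integrable M (poly p)"
proof -
  have "integrable M (\<lambda>x. \<Sum>i\<le>degree p. coeff p i * x ^ i)"
    using assms by (auto simp: finite_moments_def)
  then show ?thesis
    unfolding poly_altdef[abs_def] .
qed

section \<open>The complex power kernel and its integral transform\<close>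

definition powr_kernel :: "real \<Rightarrow> complex \<Rightarrow> real \<Rightarrow> complex" where
  "powr_kernel s w x = (w - of_real x) powr of_real s"

definition powr_transform :: "real measure \<Rightarrow> real \<Rightarrow> complex \<Rightarrow> complex" where
  "powr_transform M s w = (LINT x|M. powr_kernel s w x)"

lemma powr_kernel_add_one:
  assumes "Im w \<noteq> 0"
  shows "powr_kernel (s + 1) w x = (w - of_real x) * powr_kernel s w x"
proof -
  have "w - of_real x \<noteq> 0"
    using assms by (auto simp: complex_eq_iff)
  then show ?thesis
    by (simp add: powr_kernel_def powr_add)
qed

lemma powr_kernel_has_field_derivative:
  assumes "Im w \<noteq> 0"
  shows "((\<lambda>w. powr_kernel s w x) has_field_derivative
    of_real s * powr_kernel (s - 1) w x) (at w within A)"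
proof -
  \<comment> \<open>Subtracting a real number keeps the imaginary part, so the base stays off the
    branch cut of \<open>powr\<close>.\<close>
  have "w - of_real x \<notin> \<real>\<^sub>\<le>\<^sub>0"
    using assms by (auto simp: complex_nonpos_Reals_iff)
  then have "((\<lambda>w. powr_kernel s w x) has_field_derivative
      of_real s * powr_kernel (s - 1) w x) (at w)"
    unfolding powr_kernel_def
    using DERIV_chain2[where f = "\<lambda>z. z powr of_real s" and g = "\<lambda>w. w - of_real x"
        and x = w and s = UNIV and Db = 1, OF has_field_derivative_powr]
    by (auto intro!: derivative_eq_intros)
  then show ?thesis
    by (rule has_field_derivative_at_within)
qed

text \<open>The distance from \<open>w\<close> to any real point is at least
  \<open>\<bar>Im w\<bar>\<close>, and a nonpositive power is decreasing. The bound is uniform in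
  \<open>x\<close>.\<close>

lemma norm_powr_kernel_le:
  assumes "s \<le> 0" "0 < d" "d \<le> \<bar>Im w\<bar>"
  shows "norm (powr_kernel s w x) \<le> d powr s"
proof -
  have "d \<le> norm (w - of_real x)"
    using assms(3) abs_Im_le_cmod[of "w - of_real x"] by simp
  then show ?thesis
    using assms by (simp add: powr_kernel_def norm_powr_real_powr' powr_mono2')
qed

lemma (in real_distribution) powr_kernel_measurable [measurable]:
  assumes "Im w \<noteq> 0"
  shows "powr_kernel s w \<in> borel_measurable M"
proof -
  have "w - of_real x \<noteq> 0" for x
    using assms by (auto simp: complex_eq_iff)
  then have "continuous_on UNIV (powr_kernel s w)"
    unfolding powr_kernel_def using assms by (intro continuous_intros) auto
  then show ?thesis
    using borel_measurable_continuous_onI measurable_cong_sets[OF events_eq_borel refl] by blast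
qed

text \<open>For a nonpositive exponent the kernel is bounded in \<open>x\<close>, so finite moments
  give domination.\<close>

lemma (in real_distribution) integrable_power_powr_kernel:
  assumes "finite_moments M" "Im w \<noteq> 0" "s \<le> 0"
  shows "integrable M (\<lambda>x. of_real (x ^ i) * powr_kernel s w x)"
proof (rule Bochner_Integration.integrable_bound)
  show "integrable M (\<lambda>x. x ^ i * \<bar>Im w\<bar> powr s)"
    using assms by (auto simp: finite_moments_def)
  show "(\<lambda>x. of_real (x ^ i) * powr_kernel s w x) \<in> borel_measurable M"
    using assms by measurable
  show "AE x in M. norm (of_real (x ^ i) * powr_kernel s w x) \<le> norm (x ^ i * \<bar>Im w\<bar> powr s)"
    using norm_powr_kernel_le[of s "\<bar>Im w\<bar>" w] assms
    by (auto simp: norm_mult norm_power power_abs abs_mult intro!: mult_left_mono)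
qed

lemma (in real_distribution) integrable_powr_kernel:
  assumes "finite_moments M" "Im w \<noteq> 0"
  shows "integrable M (powr_kernel s w)"
proof -
  \<comment> \<open>Induction on a natural bound for \<open>s\<close>: splitting off a factor
    \<open>w - x\<close> lowers the exponent by one but can raise the power of \<open>x\<close>, so
    the claim is made for all \<open>i\<close> at once.\<close>
  have main: "integrable M (\<lambda>x. of_real (x ^ i) * powr_kernel s w x)" if "s \<le> real n" for n s i
    using that
  proof (induction n arbitrary: s i)
    case 0
    then show ?case
      using integrable_power_powr_kernel[OF assms] by simp
  next
    case (Suc n)
    have "integrable M (\<lambda>x. w * (of_real (x ^ i) * powr_kernel (s - 1) w x) -
        of_real (x ^ Suc i) * powr_kernel (s - 1) w x)"
      using Suc.prems by (intro Bochner_Integration.integrable_diff integrable_mult_right Suc.IH) auto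
    also have "(\<lambda>x. w * (of_real (x ^ i) * powr_kernel (s - 1) w x) -
        of_real (x ^ Suc i) * powr_kernel (s - 1) w x) = (\<lambda>x. of_real (x ^ i) * powr_kernel s w x)"
      using powr_kernel_add_one[OF assms(2), of "s - 1"]
      by (simp add: left_diff_distrib right_diff_distrib mult_ac)
    finally show ?case .
  qed
  show ?thesis
    using main[of s "nat \<lceil>s\<rceil>" 0] of_nat_ceiling[of s] by simp
qed

text \<open>For \<open>s \<le> 2\<close> the second derivative of the kernel is bounded uniformly in \<open>x\<close>, so the
  quadratic Taylor remainder survives integration and no dominated convergence is needed.\<close>

lemma (in real_distribution) powr_transform_has_field_derivative:
  assumes fm: "finite_moments M" and w: "Im w \<noteq> 0" and s: "s \<le> 2"
  shows "(powr_transform M s has_field_derivative of_real s * powr_transform M (s - 1) w) (at w)"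
proof -
  \<comment> \<open>Half the distance to the real axis: on \<open>ball w d\<close> the imaginary
    part stays at least \<open>d\<close> in absolute value.\<close>
  define d where "d = \<bar>Im w\<bar> / 2"
  have d: "0 < d"
    using w by (simp add: d_def)
  \<comment> \<open>A bound on that ball, uniform in \<open>x\<close>, for the second derivative of
    the kernel; its exponent \<open>s - 2\<close> is nonpositive.\<close>
  define B where "B = \<bar>s * (s - 1)\<bar> * d powr (s - 2)"
  have Im: "d \<le> \<bar>Im y\<bar>" if "y \<in> ball w d" for y
    using that abs_Im_le_cmod[of "w - y"] by (auto simp: d_def dist_norm)
  have taylor: "norm (powr_kernel s y x - powr_kernel s w x -
      of_real s * powr_kernel (s - 1) w x * (y - w)) \<le> B * norm (y - w) ^ 2"
    if y: "y \<in> ball w d" for y x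
  proof -
    define g where "g i v = (if i = 0 then powr_kernel s v x
      else if i = 1 then of_real s * powr_kernel (s - 1) v x
      else of_real s * (of_real (s - 1) * powr_kernel (s - 2) v x))" for i :: nat and v
    \<comment> \<open>First-order Taylor expansion with \<open>g\<close> listing the kernel and its
      first two derivatives. The remainder is divided by \<open>fact 1\<close>, so no factor 1/2
      appears in the estimate.\<close>
    have "norm (g 0 y - (\<Sum>i\<le>1. g i w * (y - w) ^ i / fact i)) \<le>
        B * norm (y - w) ^ Suc 1 / fact 1"
    proof (rule field_Taylor[of "ball w d"])
      show "(g i has_field_derivative g (Suc i) v) (at v within ball w d)"
        if "v \<in> ball w d" "i \<le> 1" for i v
      proof -
        have v: "Im v \<noteq> 0"
          using Im[OF that(1)] d by auto
        have "i = 0 \<or> i = 1"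
          using that by auto
        then show ?thesis
          using powr_kernel_has_field_derivative[OF v, of s x "ball w d"]
            DERIV_cmult[OF powr_kernel_has_field_derivative[OF v, of "s - 1" x "ball w d"], of "of_real s"]
          by (auto simp: g_def[abs_def])
      qed
      show "norm (g (Suc 1) v) \<le> B" if "v \<in> ball w d" for v
        using norm_powr_kernel_le[OF _ d Im[OF that], of "s - 2" x] s
        by (auto simp: g_def B_def norm_mult abs_mult mult.assoc simp flip: of_real_diff intro!: mult_left_mono)
    qed (use y d in auto)
    then show ?thesis
      by (simp add: g_def power2_eq_square algebra_simps)
  qed
  note int = integrable_powr_kernel[OF fm]
  show ?thesis
    unfolding has_field_derivative_def
  \<comment> \<open>The integrated remainder divided by \<open>norm (y - w)\<close> is squeezed
    below \<open>B * norm (y - w)\<close>, which tends to 0.\<close>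
  proof (rule has_derivativeI_sandwich[OF d])
    show "bounded_linear ((*) (of_real s * powr_transform M (s - 1) w))"
      by (rule bounded_linear_mult_right)
    show "((\<lambda>y. B * norm (y - w)) \<longlongrightarrow> 0) (at w)"
      by (auto intro!: tendsto_eq_intros)
    fix y assume y: "y \<noteq> w" "dist y w < d"
    then have yb: "y \<in> ball w d"
      by (simp add: dist_commute)
    then have Iy: "Im y \<noteq> 0"
      using Im d by fastforce
    have "powr_transform M s y - powr_transform M s w - of_real s * powr_transform M (s - 1) w * (y - w) =
        (LINT x|M. powr_kernel s y x - powr_kernel s w x - of_real s * powr_kernel (s - 1) w x * (y - w))"
      using int[OF w, of s] int[OF w, of "s - 1"] int[OF Iy, of s] by (simp add: powr_transform_def)
    also have "norm \<dots> \<le> (LINT x|M. B * norm (y - w) ^ 2)"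
      using int[OF w, of s] int[OF w, of "s - 1"] int[OF Iy, of s] taylor[OF yb]
      by (intro Bochner_Integration.integral_norm_bound_integral) auto
    also have "\<dots> = B * norm (y - w) ^ 2"
      using prob_space by simp
    finally show "norm (powr_transform M s y - powr_transform M s w -
        of_real s * powr_transform M (s - 1) w * (y - w)) / norm (y - w) \<le> B * norm (y - w)"
      using y by (simp add: divide_simps power2_eq_square mult_ac)
  qed
qed

text \<open>Used with \<open>s = - l\<close>, where the integrals on the right come from the
  generating function; the next lemma expands the square of \<open>w - x\<close> for the same
  purpose.\<close>

lemma (in real_distribution) powr_transform_add_one:
  assumes "integrable M (powr_kernel s w)" "integrable M (\<lambda>x. of_real x * powr_kernel s w x)"
    and "Im w \<noteq> 0"
  shows "powr_transform M (s + 1) w =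
    w * powr_transform M s w - (LINT x|M. of_real x * powr_kernel s w x)"
  using assms by (simp add: powr_transform_def powr_kernel_add_one left_diff_distrib)

lemma (in real_distribution) powr_transform_add_two:
  assumes "integrable M (powr_kernel s w)" "integrable M (\<lambda>x. of_real x * powr_kernel s w x)"
    and "integrable M (\<lambda>x. of_real (x\<^sup>2) * powr_kernel s w x)" and w: "Im w \<noteq> 0"
  shows "powr_transform M (s + 2) w =
    w\<^sup>2 * powr_transform M s w - 2 * w * (LINT x|M. of_real x * powr_kernel s w x)
    + (LINT x|M. of_real (x\<^sup>2) * powr_kernel s w x)"
proof -
  have "powr_kernel (s + 2) w x = w\<^sup>2 * powr_kernel s w x - 2 * w * (of_real x * powr_kernel s w x)
      + of_real (x\<^sup>2) * powr_kernel s w x" for x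
    using powr_kernel_add_one[OF w, of s x] powr_kernel_add_one[OF w, of "s + 1" x]
    by (simp add: add.assoc power2_eq_square) (simp add: algebra_simps)
  then show ?thesis
    using assms by (simp add: powr_transform_def)
qed

section \<open>Algebraic elimination of the derivative of \<open>u\<close>\<close>

text \<open>Multiplying the second equation by \<open>F - l * z\<close> lets the first replace
  \<open>v'\<close>, so there is no division by \<open>F - l * z\<close>; afterwards the common
  factor \<open>v\<close> cancels.\<close>

lemma eliminate_log_derivative:
  fixes l a d z F F' v v' :: complex
  assumes "v' * (F - l * z) = l * v * (1 - F')"
    and "v' * (F\<^sup>2 - 2 * l * z * F + (1 + l * a * z + l * d * z\<^sup>2))
      + v * (2 * F * F' - 2 * l * (F + z * F') + (l * a + 2 * (l * d) * z)) =
      (2 - l) * (v * (F - l * z)) * F'"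
    and "v \<noteq> 0" "l \<noteq> 0"
  shows "(l * (l - d) * z\<^sup>2 - l * a * z - 1) * F' =
    F\<^sup>2 - (a + 2 * d * z) * F + (l * d * z\<^sup>2 - 1)"
proof -
  \<comment> \<open>\<open>v * g\<close> and \<open>v * A\<close> stand for the transforms at
    exponents \<open>1 - l\<close> and \<open>2 - l\<close>; \<open>B\<close> is the
    \<open>z\<close>-derivative of \<open>A\<close>.\<close>
  define g A B where "g = F - l * z" and "A = F\<^sup>2 - 2 * l * z * F + (1 + l * a * z + l * d * z\<^sup>2)"
    and "B = 2 * F * F' - 2 * l * (F + z * F') + (l * a + 2 * (l * d) * z)"
  have "v * (l * (1 - F') * A + B * g - (2 - l) * g\<^sup>2 * F') =
      (l * v * (1 - F')) * A + v * B * g - (2 - l) * (v * g) * F' * g"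
    by (simp add: power2_eq_square algebra_simps)
  also have "\<dots> = (v' * A + v * B - (2 - l) * (v * g) * F') * g"
    by (simp only: assms(1)[symmetric] g_def[symmetric]) (simp add: algebra_simps)
  also have "\<dots> = 0"
    using assms(2) by (simp add: g_def A_def B_def)
  finally have "l * (1 - F') * A + B * g - (2 - l) * g\<^sup>2 * F' = 0"
    using assms(3) by simp
  \<comment> \<open>The terms in \<open>F\<^sup>2 * F'\<close> and \<open>z * F * F'\<close> cancel,
    leaving a polynomial in \<open>z\<close> alone as the coefficient of \<open>F'\<close>.\<close>
  also have "l * (1 - F') * A + B * g - (2 - l) * g\<^sup>2 * F' =
      l * ((l * (l - d) * z\<^sup>2 - l * a * z - 1) * F' -
        (F\<^sup>2 - (a + 2 * d * z) * F + (l * d * z\<^sup>2 - 1)))"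
    by (simp add: g_def A_def B_def power2_eq_square algebra_simps)
  finally show ?thesis
    using assms(4) by simp
qed

section \<open>Integrals of the orthogonal polynomials against 1, \<open>x\<close> and
  \<open>x\<^sup>2\<close>\<close>

locale standard_orthogonal_polys = real_distribution M for M +
  fixes P :: "nat \<Rightarrow> real poly" and \<alpha> \<omega> :: "nat \<Rightarrow> real"
  assumes finite_moments: "finite_moments M"
    and standard: "standard_measure M"
    and orthogonal: "monic_orthogonal_polys M P"
    and recurrence: "jacobi_szego P \<alpha> \<omega>"
begin

lemma integral_mult_eq_0:
  assumes "m \<noteq> n"
  shows "(LINT x|M. poly (P m) x * poly (P n) x) = 0"
  using orthogonal assms by (simp add: monic_orthogonal_polys_def)

lemma integral_x_mult:
  "(LINT x|M. x * poly (P n) x * poly (P m) x) =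
    (LINT x|M. poly (P (Suc n)) x * poly (P m) x) + \<alpha> n * (LINT x|M. poly (P n) x * poly (P m) x)
    + (if n = 0 then 0 else \<omega> n * (LINT x|M. poly (P (n - 1)) x * poly (P m) x))"
proof -
  have int: "integrable M (\<lambda>x. poly p x * poly q x)" for p q
    using integrable_poly[OF finite_moments, of "p * q"] by (simp add: poly_mult[abs_def])
  have "[:0, 1:] * P n = P (Suc n) + smult (\<alpha> n) (P n) + smult (\<omega> n) (if n = 0 then 0 else P (n - 1))"
    using recurrence by (auto simp: jacobi_szego_def)
  from arg_cong[OF this, of "\<lambda>p. poly p x" for x]
  have "x * poly (P n) x = poly (P (Suc n)) x + \<alpha> n * poly (P n) x
      + (if n = 0 then 0 else \<omega> n * poly (P (n - 1)) x)" for x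
    by (simp split: if_splits)
  then show ?thesis
    using int by (simp add: distrib_right mult.assoc)
qed

lemma P_0: "P 0 = 1"
proof -
  have deg: "degree (P 0) = 0" and "coeff (P 0) (degree (P 0)) = 1"
    using orthogonal unfolding monic_orthogonal_polys_def by blast+
  then have "coeff (P 0) 0 = 1"
    by (simp only:)
  then show ?thesis
    using degree_0_id[OF deg] by (simp add: one_pCons)
qed

lemma integral_x: "(LINT x|M. x) = 0" and integral_x2: "(LINT x|M. x\<^sup>2) = 1"
  using standard unfolding standard_measure_def by auto

lemma poly_P_1: "poly (P 1) x = x"
proof -
  \<comment> \<open>Integrating the recurrence at index 0 gives the mean on the left and
    \<open>\<alpha> 0\<close> on the right, since \<open>P 1\<close> is orthogonal to 1.\<close>
  have "\<alpha> 0 = 0"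
    using integral_x_mult[of 0 0] integral_mult_eq_0[of 1 0] integral_x prob_space by (simp add: P_0)
  moreover have "[:0, 1:] * P 0 = P 1 + smult (\<alpha> 0) (P 0)"
    using recurrence by (auto simp: jacobi_szego_def dest!: spec[of _ 0])
  ultimately have "P 1 = [:0, 1:]"
    by (simp add: P_0)
  then show ?thesis
    by simp
qed

lemma integral_P: "(LINT x|M. poly (P n) x) = (if n = 0 then 1 else 0)"
  using integral_mult_eq_0[of 0 n] prob_space by (auto simp: P_0)

text \<open>Since \<open>x\<close> is \<open>P 1\<close>, orthogonality removes every other index,
  and index 1 gives the unit second moment.\<close>

lemma integral_x_P: "(LINT x|M. x * poly (P n) x) = (if n = 1 then 1 else 0)"
  using integral_mult_eq_0[of 1 n] integral_x2 unfolding poly_P_1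
  by (auto simp: poly_P_1[unfolded One_nat_def] power2_eq_square)

lemma integral_x2_P:
  "(LINT x|M. x\<^sup>2 * poly (P n) x) =
    (if n = 0 then 1 else if n = 1 then \<alpha> 1 else if n = 2 then \<omega> 2 else 0)"
proof -
  \<comment> \<open>The recurrence at index 1 expands \<open>x\<^sup>2\<close> as
    \<open>P 2 + \<alpha> 1 * P 1 + \<omega> 1 * P 0\<close>.\<close>
  have x2: "(LINT x|M. x\<^sup>2 * poly (P n) x) = (LINT x|M. poly (P 2) x * poly (P n) x) +
      \<alpha> 1 * (LINT x|M. x * poly (P n) x) + \<omega> 1 * (LINT x|M. poly (P n) x)" for n
    using integral_x_mult[of 1 n] by (simp add: poly_P_1[unfolded One_nat_def] P_0 power2_eq_square numeral_2_eq_2)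
  \<comment> \<open>Here \<open>x2\<close> would only give the squared norm of \<open>P 2\<close>.
    Expanding \<open>x * P 2\<close> instead and pairing it with \<open>P 1\<close> leaves
    \<open>\<omega> 2\<close> times the second moment.\<close>
  have "(LINT x|M. x\<^sup>2 * poly (P 2) x) = \<omega> 2"
    using integral_x_mult[of 2 1] integral_mult_eq_0[of 3 1] integral_x2
      integral_x_P[of 2]
    by (simp add: poly_P_1[unfolded One_nat_def] power2_eq_square mult_ac numeral_3_eq_3)
  moreover have "(LINT x|M. x\<^sup>2 * poly (P n) x) = (if n = 1 then \<alpha> 1 else 0)" if "n \<noteq> 0" "n \<noteq> 2"
    using x2[of n] that integral_mult_eq_0[of 2 n] by (auto simp: integral_P integral_x_P)
  ultimately show ?thesis
    using integral_x2 P_0 by auto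
qed

end

section \<open>Integral identities from the generating function\<close>

locale ultraspherical = standard_orthogonal_polys +
  fixes l :: real and S :: "complex set" and u f :: "complex \<Rightarrow> complex"
  assumes l_pos: "l > 0"
    and gf: "ultraspherical_gf l M P S u f"
    and interchange: "interchange_condition l M P S"
begin

text \<open>\<open>l * riccati_coeff\<close> is the coefficient of \<open>z\<^sup>2\<close> obtained
  by integrating \<open>x\<^sup>2\<close> against the generating function. The factor
  \<open>l\<close> is taken out because it cancels in the Riccati equation.\<close>

definition riccati_coeff :: real where
  "riccati_coeff = (l + 1) * \<omega> 2 / 2"

lemma Im_f: "z \<in> S \<Longrightarrow> Im (f z) \<noteq> 0"
  using gf by (simp add: ultraspherical_gf_def)

lemma suminf_quadratic:
  fixes c :: "nat \<Rightarrow> real"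
  assumes "\<And>n. n > 2 \<Longrightarrow> c n = 0"
  shows "(\<Sum>n. complex_of_real (pochhammer l n / fact n * c n) * z ^ n) =
    of_real (c 0) + of_real (l * c 1) * z + of_real (l * (l + 1) * c 2 / 2) * z\<^sup>2"
proof -
  have "(\<Sum>n. complex_of_real (pochhammer l n / fact n * c n) * z ^ n) =
      (\<Sum>n\<in>{0, 1, 2}. complex_of_real (pochhammer l n / fact n * c n) * z ^ n)"
    using assms by (intro suminf_finite) auto
  then show ?thesis
    by (simp add: numeral_2_eq_2 pochhammer_Suc)
qed

text \<open>On the support, hence almost everywhere, the integrand is \<open>x ^ i\<close> times the
  generating series; the interchange condition then integrates termwise.\<close>

lemma integral_generating_function:
  assumes z: "z \<in> S" and i: "i \<le> 2"
  shows "(LINT x|M. of_real (x ^ i) * powr_kernel (- l) (f z) x) / u z =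
    (\<Sum>n. complex_of_real (pochhammer l n / fact n * (LINT x|M. x ^ i * poly (P n) x)) * z ^ n)"
proof -
  note [measurable] = powr_kernel_measurable[OF Im_f[OF z]]
  have [measurable]: "(\<lambda>x. poly p x) \<in> borel_measurable M" for p :: "real poly"
    using integrable_poly[OF finite_moments, of p] by simp
  have "(LINT x|M. of_real (x ^ i) * powr_kernel (- l) (f z) x) / u z =
      (LINT x|M. of_real (x ^ i) * powr_kernel (- l) (f z) x / u z)"
    by simp
  also have "\<dots> = (LINT x|M. (\<Sum>n. complex_of_real (pochhammer l n / fact n * (x ^ i * poly (P n) x)) * z ^ n))"
  proof (rule integral_cong_AE)
    show "AE x in M. of_real (x ^ i) * powr_kernel (- l) (f z) x / u z =
        (\<Sum>n. complex_of_real (pochhammer l n / fact n * (x ^ i * poly (P n) x)) * z ^ n)"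
      using AE_measure_supp
    proof eventually_elim
      case (elim x)
      then have "(\<lambda>n. of_real (pochhammer l n / fact n * poly (P n) x) * z ^ n)
          sums (1 / (u z * (f z - of_real x) powr of_real l))"
        using gf z by (simp add: ultraspherical_gf_def)
      from sums_mult[OF this, of "of_real (x ^ i)"]
      have "(\<lambda>n. complex_of_real (pochhammer l n / fact n * (x ^ i * poly (P n) x)) * z ^ n)
          sums (of_real (x ^ i) * powr_kernel (- l) (f z) x / u z)"
        by (simp add: powr_kernel_def powr_minus_divide mult_ac)
      then show ?case
        by (simp add: sums_iff)
    qed
  qed measurable
  also have "\<dots> = (\<Sum>n. complex_of_real (pochhammer l n / fact n * (LINT x|M. x ^ i * poly (P n) x)) * z ^ n)"
  proof -
    have "i \<in> {0, 1, 2}"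
      using i by auto
    then show ?thesis
      using interchange z unfolding interchange_condition_def by blast
  qed
  finally show ?thesis .
qed

text \<open>For \<open>i = 0\<close> orthogonality reduces the series to 1, whereas a quotient with
  \<open>u z = 0\<close> would have the value 0.\<close>

lemma u_nonzero:
  assumes "z \<in> S"
  shows "u z \<noteq> 0"
proof -
  have "(LINT x|M. of_real (x ^ 0) * powr_kernel (- l) (f z) x) / u z =
      (\<Sum>n. complex_of_real (pochhammer l n / fact n * (if n = 0 then 1 else 0)) * z ^ n)"
    using integral_generating_function[OF assms, of 0]
    by (simp only: power_0 mult_1 integral_P zero_le)
  also have "\<dots> = 1"
    by (subst suminf_quadratic) simp_all
  finally show ?thesis
    by auto
qed

lemma integral_power_powr_kernel:
  assumes "z \<in> S" "i \<le> 2" "\<And>n. n > 2 \<Longrightarrow> (LINT x|M. x ^ i * poly (P n) x) = 0"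
  shows "(LINT x|M. of_real (x ^ i) * powr_kernel (- l) (f z) x) =
    u z * (of_real (LINT x|M. x ^ i * poly (P 0) x) + of_real (l * (LINT x|M. x ^ i * poly (P 1) x)) * z
      + of_real (l * (l + 1) * (LINT x|M. x ^ i * poly (P 2) x) / 2) * z\<^sup>2)"
  using integral_generating_function[OF assms(1,2)] u_nonzero[OF assms(1)] suminf_quadratic[OF assms(3)]
  by (simp add: divide_eq_eq mult.commute)

text \<open>The cases \<open>i = 0, 1, 2\<close>, where orthogonality leaves only terms with index
  at most \<open>i\<close>.\<close>

lemma integral_powr_kernel:
  assumes "z \<in> S"
  shows "powr_transform M (- l) (f z) = u z"
    and "(LINT x|M. of_real x * powr_kernel (- l) (f z) x) = u z * (of_real l * z)"
    and "(LINT x|M. of_real (x\<^sup>2) * powr_kernel (- l) (f z) x) =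
      u z * (1 + of_real (l * \<alpha> 1) * z + of_real (l * riccati_coeff) * z\<^sup>2)"
  using integral_power_powr_kernel[OF assms, of 0] integral_power_powr_kernel[OF assms, of 1]
    integral_power_powr_kernel[OF assms, of 2]
  by (simp_all add: powr_transform_def integral_P integral_x_P integral_x2_P riccati_coeff_def mult.assoc
      del: One_nat_def of_real_power)

lemma powr_transform_f:
  assumes z: "z \<in> S"
  shows "powr_transform M (1 - l) (f z) = u z * (f z - of_real l * z)"
    and "powr_transform M (2 - l) (f z) =
      u z * ((f z)\<^sup>2 - 2 * of_real l * z * f z + (1 + of_real (l * \<alpha> 1) * z + of_real (l * riccati_coeff) * z\<^sup>2))"
  using powr_transform_add_one[of "- l" "f z"] powr_transform_add_two[of "- l" "f z"]
    integral_powr_kernel[OF z] Im_f[OF z] l_pos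
    integrable_powr_kernel[OF finite_moments, of "f z" "- l"]
    integrable_power_powr_kernel[OF finite_moments, of "f z" "- l" 1]
    integrable_power_powr_kernel[OF finite_moments, of "f z" "- l" 2]
  by (simp_all add: algebra_simps)

section \<open>Differentiation of the identities in \<open>z\<close>\<close>

lemma derivs:
  assumes "z \<in> S"
  shows "(f has_field_derivative deriv f z) (at z)" "(u has_field_derivative deriv u z) (at z)"
proof -
  have "f analytic_on S" "u analytic_on S"
    using gf by (simp_all add: ultraspherical_gf_def)
  with assms show "(f has_field_derivative deriv f z) (at z)" "(u has_field_derivative deriv u z) (at z)"
    by (auto simp: DERIV_deriv_iff_field_differentiable intro: analytic_on_imp_differentiable_at)
qed

text \<open>The two sides of \<open>eq\<close> agree on the open set \<open>S\<close>, so the chain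
  rule and uniqueness of derivatives apply.\<close>

lemma deriv_transform:
  assumes z: "z \<in> S" and s: "s \<le> 2" and g: "(g has_field_derivative D) (at z)"
    and eq: "\<And>y. y \<in> S \<Longrightarrow> powr_transform M s (f y) = g y"
  shows "D = of_real s * powr_transform M (s - 1) (f z) * deriv f z"
proof -
  have "((\<lambda>y. powr_transform M s (f y)) has_field_derivative
      of_real s * powr_transform M (s - 1) (f z) * deriv f z) (at z)"
    using DERIV_chain2[OF powr_transform_has_field_derivative[OF finite_moments Im_f[OF z] s] derivs(1)[OF z]] .
  moreover have "open S"
    using gf by (simp add: ultraspherical_gf_def slit_region_def)
  ultimately have "(g has_field_derivative of_real s * powr_transform M (s - 1) (f z) * deriv f z) (at z)"
    using z by (rule has_field_derivative_transform_within_open) (rule eq)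
  then show ?thesis
    using g DERIV_unique by blast
qed

text \<open>At exponent \<open>1 - l\<close> the derivative involves the transform at
  \<open>- l\<close>, which is \<open>u\<close> itself. The product form remains meaningful where
  \<open>f z = l * z\<close>.\<close>

lemma deriv_u:
  assumes z: "z \<in> S"
  shows "deriv u z * (f z - of_real l * z) = of_real l * u z * (1 - deriv f z)"
proof -
  have "((\<lambda>y. u y * (f y - of_real l * y)) has_field_derivative
      deriv u z * (f z - of_real l * z) + u z * (deriv f z - of_real l)) (at z)"
    by (auto intro!: derivative_eq_intros derivs[OF z])
  from deriv_transform[OF z _ this, of "1 - l"]
  show ?thesis
    using l_pos integral_powr_kernel(1)[OF z] powr_transform_f(1) by (simp add: algebra_simps)
qed

text \<open>At exponent \<open>2 - l\<close>, below 2 because \<open>l\<close> is positive, the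
  derivative involves the transform at \<open>1 - l\<close>, which is
  \<open>u z * (f z - l * z)\<close>. Combining this with \<open>deriv_u\<close> eliminates
  \<open>deriv u z\<close>.\<close>

lemma deriv_f:
  assumes z: "z \<in> S"
  shows "(of_real (l * (l - riccati_coeff)) * z\<^sup>2 - of_real (l * \<alpha> 1) * z - 1) * deriv f z =
    (f z)\<^sup>2 - (of_real (\<alpha> 1) + 2 * of_real riccati_coeff * z) * f z + (of_real (l * riccati_coeff) * z\<^sup>2 - 1)"
proof -
  have "((\<lambda>y. u y * ((f y)\<^sup>2 - 2 * of_real l * y * f y + (1 + of_real (l * \<alpha> 1) * y + of_real (l * riccati_coeff) * y\<^sup>2)))
      has_field_derivative
      deriv u z * ((f z)\<^sup>2 - 2 * of_real l * z * f z + (1 + of_real (l * \<alpha> 1) * z + of_real (l * riccati_coeff) * z\<^sup>2))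
      + u z * (2 * f z * deriv f z - 2 * of_real l * (f z + z * deriv f z)
        + (of_real (l * \<alpha> 1) + 2 * of_real (l * riccati_coeff) * z))) (at z)"
    by (auto intro!: derivative_eq_intros derivs[OF z]) (simp add: distrib_left mult_ac)
  from deriv_transform[OF z _ this, of "2 - l"]
  have "deriv u z * ((f z)\<^sup>2 - 2 * of_real l * z * f z + (1 + of_real (l * \<alpha> 1) * z + of_real (l * riccati_coeff) * z\<^sup>2))
      + u z * (2 * f z * deriv f z - 2 * of_real l * (f z + z * deriv f z)
        + (of_real (l * \<alpha> 1) + 2 * of_real (l * riccati_coeff) * z)) =
      (2 - of_real l) * (u z * (f z - of_real l * z)) * deriv f z"
    using l_pos powr_transform_f[OF z] powr_transform_f(2) by simp
  with deriv_u[OF z] u_nonzero[OF z] l_pos show ?thesis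
    using eliminate_log_derivative[where v = "u z" and v' = "deriv u z" and F = "f z" and F' = "deriv f z"
        and z = z and l = "of_real l" and a = "of_real (\<alpha> 1)" and d = "of_real riccati_coeff"]
    by simp
qed

end

section \<open>The coefficient polynomials and their degrees\<close>

theorem proposition1p1:
  shows "\<exists>Q2 Q1 R1 :: real \<Rightarrow> real \<Rightarrow> real \<Rightarrow> complex poly.
    (\<forall>l a w. l > 0 \<longrightarrow>
       degree (Q2 l a w) \<le> 2 \<and> ((l + 1) * w \<noteq> 2 * l \<longrightarrow> degree (Q2 l a w) = 2) \<and>
       degree (Q1 l a w) \<le> 1 \<and> (w \<noteq> 0 \<longrightarrow> degree (Q1 l a w) = 1) \<and>
       degree (R1 l a w) \<le> 2 \<and> (w \<noteq> 0 \<longrightarrow> degree (R1 l a w) = 2)) \<and>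
    (\<forall>(l::real) (\<mu>::real measure) (P::nat \<Rightarrow> real poly) (\<alpha>::nat \<Rightarrow> real) (\<omega>::nat \<Rightarrow> real)
        (S::complex set) (u::complex \<Rightarrow> complex) (f::complex \<Rightarrow> complex).
       l > 0 \<and> real_distribution \<mu> \<and> finite_moments \<mu> \<and> standard_measure \<mu> \<and>
       monic_orthogonal_polys \<mu> P \<and> jacobi_szego P \<alpha> \<omega> \<and>
       ultraspherical_gf l \<mu> P S u f \<and> interchange_condition l \<mu> P S
       \<longrightarrow>
       (\<forall>z\<in>S. poly (Q2 l (\<alpha> 1) (\<omega> 2)) z * deriv f z
                = (f z)\<^sup>2 - poly (Q1 l (\<alpha> 1) (\<omega> 2)) z * f z + poly (R1 l (\<alpha> 1) (\<omega> 2)) z) \<and>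
       (\<forall>z\<in>S. f z \<noteq> of_real l * z \<longrightarrow>
          deriv u z / u z = of_real l * ((1 - deriv f z) / (f z - of_real l * z))))"
proof -
  \<comment> \<open>\<open>d\<close> is \<open>riccati_coeff\<close> as a function of the parameters
    alone, so the polynomials can be chosen before the measure. Their coefficients are read off from
    \<open>deriv_f\<close>, constant term first.\<close>
  define d where "d l w = (l + 1) * w / 2" for l w :: real
  define Q2 where "Q2 l a w = ([:-1, - of_real (l * a), of_real (l * (l - d l w)):] :: complex poly)" for l a w :: real
  define Q1 where "Q1 l a w = ([:of_real a, 2 * of_real (d l w):] :: complex poly)" for l a w :: real
  define R1 where "R1 l a w = ([:-1, 0, of_real (l * d l w):] :: complex poly)" for l a w :: real
  have degrees: "degree (Q2 l a w) \<le> 2 \<and> ((l + 1) * w \<noteq> 2 * l \<longrightarrow> degree (Q2 l a w) = 2) \<and>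
       degree (Q1 l a w) \<le> 1 \<and> (w \<noteq> 0 \<longrightarrow> degree (Q1 l a w) = 1) \<and>
       degree (R1 l a w) \<le> 2 \<and> (w \<noteq> 0 \<longrightarrow> degree (R1 l a w) = 2)"
    if "l > 0" for l a w :: real
  proof -
    \<comment> \<open>These are exactly the cases in which a leading coefficient vanishes:
      \<open>l * (l - d l w)\<close> for \<open>Q2\<close>, and \<open>2 * d l w\<close> and
      \<open>l * d l w\<close> for \<open>Q1\<close> and \<open>R1\<close>.\<close>
    have "d l w = l \<longleftrightarrow> (l + 1) * w = 2 * l" "d l w = 0 \<longleftrightarrow> w = 0"
      using that unfolding d_def by auto
    then show ?thesis
      using that by (auto simp: Q2_def Q1_def R1_def)
  qed
  have equations: "(\<forall>z\<in>S. poly (Q2 l (\<alpha> 1) (\<omega> 2)) z * deriv f z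
                = (f z)\<^sup>2 - poly (Q1 l (\<alpha> 1) (\<omega> 2)) z * f z + poly (R1 l (\<alpha> 1) (\<omega> 2)) z) \<and>
       (\<forall>z\<in>S. f z \<noteq> of_real l * z \<longrightarrow>
          deriv u z / u z = of_real l * ((1 - deriv f z) / (f z - of_real l * z)))"
    if "ultraspherical M P \<alpha> \<omega> l S u f" for M P \<alpha> \<omega> l S u f
  proof -
    interpret ultraspherical M P \<alpha> \<omega> l S u f
      by (fact that)
    have "poly (Q2 l (\<alpha> 1) (\<omega> 2)) z = of_real (l * (l - riccati_coeff)) * z\<^sup>2 - of_real (l * \<alpha> 1) * z - 1"
      and "poly (Q1 l (\<alpha> 1) (\<omega> 2)) z = of_real (\<alpha> 1) + 2 * of_real riccati_coeff * z"
      and "poly (R1 l (\<alpha> 1) (\<omega> 2)) z = of_real (l * riccati_coeff) * z\<^sup>2 - 1" for z :: complex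
      by (simp_all add: Q2_def Q1_def R1_def d_def riccati_coeff_def power2_eq_square algebra_simps)
    \<comment> \<open>Dividing \<open>deriv_u\<close> requires both \<open>u z\<close> and
      \<open>f z - l * z\<close> to be nonzero.\<close>
    moreover have "deriv u z / u z = of_real l * ((1 - deriv f z) / (f z - of_real l * z))"
      if z: "z \<in> S" and ne: "f z \<noteq> of_real l * z" for z
    proof -
      have "f z - of_real l * z \<noteq> 0"
        using ne by simp
      then show ?thesis
        using deriv_u[OF z] u_nonzero[OF z] by (simp add: frac_eq_eq mult_ac)
    qed
    ultimately show ?thesis
      using deriv_f by simp
  qed
  have ultraspherical: "ultraspherical M P \<alpha> \<omega> l S u f"
    if "l > 0 \<and> real_distribution M \<and> finite_moments M \<and> standard_measure M \<and>
       monic_orthogonal_polys M P \<and> jacobi_szego P \<alpha> \<omega> \<and>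
       ultraspherical_gf l M P S u f \<and> interchange_condition l M P S" for l M P \<alpha> \<omega> S u f
    using that
    by (simp add: ultraspherical_def standard_orthogonal_polys_def ultraspherical_axioms_def
        standard_orthogonal_polys_axioms_def)
  show ?thesis
    by (rule exI[of _ Q2], rule exI[of _ Q1], rule exI[of _ R1], rule conjI)
      (intro allI impI, (rule degrees | rule equations, rule ultraspherical), assumption)+
qed

end
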